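(* Let $(\Omega,\Sigma,\mu)$ be a probability space, let $H,K$ be complex Hilbert spaces, and let $f\in L^2(\Omega,H)$ and $g\in L^2(\Omega,K)$ be zero-mean random functions. Let $P=E_{ff}^{-1}\{0\}$ and $Q=E_{gf}^{-1}\{0\}$ denote the null spaces of the auto-covariance operator $E_{ff}$ and the cross-covariance operator $E_{gf}$ respectively. Then $P\subseteq Q\subseteq H$.
   Context: $L^2(\Omega,H)$ is the space of functions $f:\Omega\to H$ that are strongly $\Sigma$-measurable ($\mu$-almost everywhere norm limits of sequences of finitely valued functions, i.e. finite sums $\sum_j\chi_{E_j}c_j$ with $E_j\in\Sigma$ disjoint, $c_j\in H$) with $\mathbb{E}[\|f\|^2]=\int_\Omega\|f(\omega)\|^2\mu(d\omega)<\infty$; similarly for $K$. Integrals of Hilbert space valued functions are Bochner integrals; zero mean means $\int_\Omega f\,d\mu=0$. Inner products are linear in the first argument. The covariance operators are $E_{ff}\in\mathcal{B}(H)$, $E_{ff}x=\int_\Omega\langle x,f(\omega)\rangle f(\omega)\,\mu(d\omega)$, and $E_{gf}\in\mathcal{B}(H,K)$, $E_{gf}x=\int_\Omega\langle x,f(\omega)\rangle g(\omega)\,\mu(d\omega)$, $x\in H$. *)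

theory Defs
  imports "HOL-Probability.Probability"
begin

class complex_vector = real_vector +
  fixes scaleC :: "complex \<Rightarrow> 'a \<Rightarrow> 'a" (infixr \<open>*\<^sub>C\<close> 75)
  assumes scaleC_add_right: "a *\<^sub>C (x + y) = a *\<^sub>C x + a *\<^sub>C y"
    and scaleC_add_left: "(a + b) *\<^sub>C x = a *\<^sub>C x + b *\<^sub>C x"
    and scaleC_scaleC: "a *\<^sub>C b *\<^sub>C x = (a * b) *\<^sub>C x"
    and scaleC_one: "1 *\<^sub>C x = x"
    and scaleR_eq_scaleC: "r *\<^sub>R x = complex_of_real r *\<^sub>C x"

text \<open>The inner product is linear in the first argument and conjugate-linear in the second.\<close>

class complex_inner = complex_vector + real_normed_vector +
  fixes cinner :: "'a \<Rightarrow> 'a \<Rightarrow> complex"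
  assumes cinner_commute: "cinner x y = cnj (cinner y x)"
    and cinner_add_left: "cinner (x + y) z = cinner x z + cinner y z"
    and cinner_scaleC_left: "cinner (a *\<^sub>C x) y = a * cinner x y"
    and cinner_ge_zero: "0 \<le> Re (cinner x x)"
    and cinner_eq_zero_iff: "cinner x x = 0 \<longleftrightarrow> x = 0"
    and norm_eq_sqrt_cinner: "norm x = sqrt (Re (cinner x x))"

class complex_hilbert_space = complex_inner + complete_space

instantiation complex :: complex_hilbert_space
begin
definition scaleC_complex :: "complex \<Rightarrow> complex \<Rightarrow> complex" where
  "scaleC_complex a x = a * x"
definition cinner_complex :: "complex \<Rightarrow> complex \<Rightarrow> complex" where
  "cinner_complex x y = x * cnj y"
instance
proof
  fix a b x y z :: complex and r :: real
  show "a *\<^sub>C (x + y) = a *\<^sub>C x + a *\<^sub>C y" "(a + b) *\<^sub>C x = a *\<^sub>C x + b *\<^sub>C x"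
    "a *\<^sub>C b *\<^sub>C x = (a * b) *\<^sub>C x" "1 *\<^sub>C x = x" "r *\<^sub>R x = complex_of_real r *\<^sub>C x"
    by (simp_all add: scaleC_complex_def distrib_left distrib_right mult.assoc scaleR_conv_of_real)
  show "cinner x y = cnj (cinner y x)" "cinner (x + y) z = cinner x z + cinner y z"
    "cinner (a *\<^sub>C x) y = a * cinner x y" "0 \<le> Re (cinner x x)" "cinner x x = 0 \<longleftrightarrow> x = 0"
    by (simp_all add: scaleC_complex_def cinner_complex_def algebra_simps)
  show "norm x = sqrt (Re (cinner x x))"
    by (simp add: cinner_complex_def cmod_def power2_eq_square)
qed
end

text \<open>
  The library's Bochner integral \<^const>\<open>has_bochner_integral\<close> is only available for second
  countable (i.e. separable) codomains. The notions below have no separability assumption.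
\<close>

definition strongly_measurable :: "'a measure \<Rightarrow> ('a \<Rightarrow> 'b::real_normed_vector) \<Rightarrow> bool" where
  "strongly_measurable M f \<longleftrightarrow>
    (\<exists>s. (\<forall>n. simple_function M (s n)) \<and> (AE \<omega> in M. (\<lambda>n. s n \<omega>) \<longlonglongrightarrow> f \<omega>))"

text \<open>
  For strongly measurable \<open>f\<close> the norm of \<open>f\<close> agrees almost everywhere with an
  \<open>M\<close>-measurable function, so \<^const>\<open>nn_integral\<close>, which respects almost-everywhere equality
  even without measurability, gives the usual integral although \<open>M\<close> need not be complete.
\<close>

definition L2 :: "'a measure \<Rightarrow> ('a \<Rightarrow> 'b::real_normed_vector) set" where
  "L2 M = {f. strongly_measurable M f \<and> (\<integral>\<^sup>+\<omega>. ennreal ((norm (f \<omega>))\<^sup>2) \<partial>M) < \<infinity>}"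

definition has_strong_integral ::
    "'a measure \<Rightarrow> ('a \<Rightarrow> 'b::real_normed_vector) \<Rightarrow> 'b \<Rightarrow> bool" where
  "has_strong_integral M f I \<longleftrightarrow> strongly_measurable M f \<and>
    (\<exists>s. (\<forall>n. Bochner_Integration.simple_bochner_integrable M (s n)) \<and>
         (\<lambda>n. \<integral>\<^sup>+\<omega>. ennreal (norm (f \<omega> - s n \<omega>)) \<partial>M) \<longlonglongrightarrow> 0 \<and>
         (\<lambda>n. Bochner_Integration.simple_bochner_integral M (s n)) \<longlonglongrightarrow> I)"

text \<open>As for \<^const>\<open>lebesgue_integral\<close>, the value is \<open>0\<close> for functions without an integral.\<close>

definition strong_integral :: "'a measure \<Rightarrow> ('a \<Rightarrow> 'b::real_normed_vector) \<Rightarrow> 'b" where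
  "strong_integral M f =
    (if \<exists>I. has_strong_integral M f I then THE I. has_strong_integral M f I else 0)"

text \<open>
  \<open>covariance M g f\<close> is the cross-covariance operator $E_{gf} : H \to K$;
  the auto-covariance operator $E_{ff}$ is \<open>covariance M f f\<close>.
\<close>

definition covariance ::
    "'a measure \<Rightarrow> ('a \<Rightarrow> 'k::complex_hilbert_space) \<Rightarrow> ('a \<Rightarrow> 'h::complex_hilbert_space) \<Rightarrow> 'h \<Rightarrow> 'k"
  where
  "covariance M g f x = strong_integral M (\<lambda>\<omega>. cinner x (f \<omega>) *\<^sub>C g \<omega>)"

end

(* If E_ff x = 0 then the integral of |<x, f>|^2, which equals <E_ff x, x>, vanishes, so
   <x, f> = 0 almost everywhere and E_gf x is the integral of an almost everywhere vanishing
   function. Since strong_integral is 0 by convention on non-integrable functions, E_ff x = 0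
   only carries information once <x, f> f has been shown to be integrable. Moving <-, x> inside
   the integral reduces everything to the real-valued Lebesgue integral; the same device,
   applied to all functionals Re <-, y>, gives uniqueness of the strong integral. *)

theory Submission
  imports Defs
begin

section \<open>Complex inner product spaces\<close>

lemma cinner_add_right: "cinner x (y + z) = cinner x y + cinner x z"
  for x y z :: "'a::complex_inner"
  by (metis cinner_add_left cinner_commute complex_cnj_add)

lemma cinner_scaleC_right: "cinner x (a *\<^sub>C y) = cnj a * cinner x y"
  for x y :: "'a::complex_inner"
  by (metis cinner_scaleC_left cinner_commute complex_cnj_mult)

lemma cinner_scaleR_left: "cinner (r *\<^sub>R x) y = r *\<^sub>R cinner x y"
  for x y :: "'a::complex_inner"
  \<comment> \<open>\<open>scaleR_eq_scaleC\<close> also rewrites the real scaling on the complex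
    right-hand side, so \<open>scaleC_complex_def\<close> is needed to turn the result into a
    product.\<close>
  by (simp add: scaleR_eq_scaleC cinner_scaleC_left scaleC_complex_def)

lemma cinner_scaleR_right: "cinner x (r *\<^sub>R y) = r *\<^sub>R cinner x y"
  for x y :: "'a::complex_inner"
  by (simp add: scaleR_eq_scaleC cinner_scaleC_right scaleC_complex_def)

lemma cinner_self: "cinner x x = complex_of_real ((norm x)\<^sup>2)"
  for x :: "'a::complex_inner"
proof -
  have "Im (cinner x x) = 0"
    using arg_cong[OF cinner_commute[of x x], of Im] by simp
  moreover have "Re (cinner x x) = (norm x)\<^sup>2"
    by (simp add: norm_eq_sqrt_cinner cinner_ge_zero)
  ultimately show ?thesis
    by (simp add: complex_eq_iff)
qed

lemma norm_scaleC: "norm (a *\<^sub>C x) = cmod a * norm x"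
  for x :: "'a::complex_inner"
proof -
  have "complex_of_real ((norm (a *\<^sub>C x))\<^sup>2) = (a * cnj a) * cinner x x"
    unfolding cinner_self[symmetric] by (simp add: cinner_scaleC_left cinner_scaleC_right)
  also have "\<dots> = complex_of_real ((cmod a * norm x)\<^sup>2)"
    by (simp only: cinner_self complex_norm_square[symmetric] power_mult_distrib of_real_mult of_real_power)
  finally have "(norm (a *\<^sub>C x))\<^sup>2 = (cmod a * norm x)\<^sup>2"
    using of_real_eq_iff by blast
  then show ?thesis
    by (simp add: power2_eq_iff_nonneg)
qed

lemma scaleC_zero_left: "0 *\<^sub>C x = 0" for x :: "'a::complex_inner"
  by (metis norm_eq_zero norm_scaleC mult_zero_left norm_zero)

lemma Cauchy_Schwarz_cinner: "cmod (cinner x y) \<le> norm x * norm y"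
  for x y :: "'a::complex_inner"
proof (cases "y = 0")
  case True
  then show ?thesis
    using cinner_scaleR_right[of x 0 y] by simp
next
  case False
  define c where "c = cinner x y"
  define n where "n = (norm y)\<^sup>2"
  \<comment> \<open>\<open>z\<close> is the component of \<open>x\<close> orthogonal to
    \<open>y\<close>, multiplied by \<open>n\<close> so that no division occurs. Nonnegativity of
    \<open>cinner z z\<close> is then the squared inequality up to the factor
    \<open>n\<close>.\<close>
  define z where "z = complex_of_real n *\<^sub>C x + (- c) *\<^sub>C y"
  have n: "n > 0" using False by (simp add: n_def)
  have yx: "cinner y x = cnj c" by (metis c_def cinner_commute)
  have yy: "cinner y y = complex_of_real n" by (simp add: cinner_self n_def)
  have xx: "cinner x x = complex_of_real ((norm x)\<^sup>2)" by (rule cinner_self)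
  have cc: "c * cnj c = complex_of_real ((cmod c)\<^sup>2)"
    by (simp only: complex_norm_square)
  have "cinner z z = complex_of_real n * (complex_of_real n * cinner x x - c * cnj c)"
    unfolding z_def
    by (simp add: cinner_add_left cinner_add_right cinner_scaleC_left cinner_scaleC_right
        yx yy c_def[symmetric] algebra_simps)
  also have "\<dots> = complex_of_real (n * (n * (norm x)\<^sup>2 - (cmod c)\<^sup>2))"
    by (simp only: xx cc of_real_mult of_real_diff)
  finally have "0 \<le> n * (n * (norm x)\<^sup>2 - (cmod c)\<^sup>2)"
    using cinner_ge_zero[of z] by simp
  then have "(cmod c)\<^sup>2 \<le> (norm x * norm y)\<^sup>2"
    using n by (simp add: zero_le_mult_iff n_def power_mult_distrib mult.commute)
  then show ?thesis
    unfolding c_def by (rule power2_le_imp_le) simp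
qed

text \<open>Conjugate linearity in the second argument is still linearity over the reals, so real
  bilinearity and Cauchy-Schwarz suffice. Continuity of the inner product follows from this.\<close>

lemma bounded_bilinear_cinner:
  "bounded_bilinear (cinner :: 'a::complex_inner \<Rightarrow> 'a \<Rightarrow> complex)"
proof
  show "\<exists>K. \<forall>a b :: 'a. cmod (cinner a b) \<le> norm a * norm b * K"
    by (intro exI[of _ 1]) (simp add: Cauchy_Schwarz_cinner)
qed (simp_all add: cinner_add_left cinner_add_right cinner_scaleR_left cinner_scaleR_right)

lemma bounded_bilinear_scaleC:
  "bounded_bilinear (scaleC :: complex \<Rightarrow> 'a::complex_inner \<Rightarrow> 'a)"
proof
  show "\<exists>K. \<forall>a (b :: 'a). norm (a *\<^sub>C b) \<le> norm a * norm b * K"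
    by (intro exI[of _ 1]) (simp add: norm_scaleC)
qed (simp_all add: scaleC_add_left scaleC_add_right scaleR_eq_scaleC scaleC_scaleC
      scaleC_complex_def mult.commute)

text \<open>Taking real parts gives real-valued functionals, which carry a strong integral over to
  the ordinary Lebesgue integral.\<close>

lemma bounded_linear_Re_cinner_left:
  "bounded_linear (\<lambda>v :: 'a::complex_inner. Re (cinner v y))"
  by (intro bounded_linear_compose[OF bounded_linear_Re]
      bounded_bilinear.bounded_linear_left[OF bounded_bilinear_cinner])

section \<open>Strong measurability without separability\<close>

text \<open>The measure need not be complete, so \<open>f\<close> itself may fail to be Borel.
  Enclosing the exceptional set in a measurable null set and replacing both \<open>f\<close> and its
  approximants by 0 there yields convergence everywhere, to a Borel function that agrees with
  \<open>f\<close> almost everywhere.\<close>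

lemma strongly_measurableE:
  assumes "strongly_measurable M f"
  obtains s f' where "\<And>n. simple_function M (s n)" "\<And>\<omega>. (\<lambda>n. s n \<omega>) \<longlonglongrightarrow> f' \<omega>"
    "f' \<in> borel_measurable M" "AE \<omega> in M. f \<omega> = f' \<omega>"
proof -
  from assms obtain s where s: "\<And>n. simple_function M (s n)"
    and lim: "AE \<omega> in M. (\<lambda>n. s n \<omega>) \<longlonglongrightarrow> f \<omega>"
    by (auto simp: strongly_measurable_def)
  from lim obtain N where N: "N \<in> null_sets M"
    "{\<omega> \<in> space M. \<not> (\<lambda>n. s n \<omega>) \<longlonglongrightarrow> f \<omega>} \<subseteq> N"
    by (auto elim!: AE_E simp: null_sets_def)
  define A where "A = space M - N"
  define t where "t n \<omega> = (if \<omega> \<in> A then s n \<omega> else 0)" for n \<omega>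
  define f' where "f' \<omega> = (if \<omega> \<in> A then f \<omega> else 0)" for \<omega>
  have t: "simple_function M (t n)" for n
    unfolding t_def using N s by (intro simple_function_If_set) (auto simp: A_def)
  have tlim: "(\<lambda>n. t n \<omega>) \<longlonglongrightarrow> f' \<omega>" for \<omega>
    using N(2) by (auto simp: t_def f'_def A_def)
  have "f' \<in> borel_measurable M"
    \<comment> \<open>Pointwise limits of Borel functions into a metric space are Borel without any
      separability.\<close>
    by (rule borel_measurable_LIMSEQ_metric[OF borel_measurable_simple_function[OF t] tlim])
  moreover have "AE \<omega> in M. f \<omega> = f' \<omega>"
    using AE_not_in[OF N(1)] AE_space by eventually_elim (simp add: f'_def A_def)
  ultimately show ?thesis
    using that t tlim by blast
qed

lemma strongly_measurable_continuous_compose: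
  assumes "strongly_measurable M f" and "continuous_on UNIV h"
  shows "strongly_measurable M (\<lambda>\<omega>. h (f \<omega>))"
proof -
  from assms(1) obtain s where s: "\<And>n. simple_function M (s n)"
    and lim: "AE \<omega> in M. (\<lambda>n. s n \<omega>) \<longlonglongrightarrow> f \<omega>"
    by (auto simp: strongly_measurable_def)
  have "AE \<omega> in M. (\<lambda>n. h (s n \<omega>)) \<longlonglongrightarrow> h (f \<omega>)"
    using lim
    by eventually_elim (auto intro: continuous_on_tendsto_compose[OF assms(2)])
  with s show ?thesis
    unfolding strongly_measurable_def
    by (intro exI[of _ "\<lambda>n \<omega>. h (s n \<omega>)"]) (auto intro: simple_function_compose1)
qed

text \<open>Without separability, differences of Borel functions need not be Borel. The norm of the
  difference is therefore obtained directly as a limit of simple real functions.\<close>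

lemma strongly_measurable_norm_diff:
  fixes f :: "'a \<Rightarrow> 'b::real_normed_vector"
  assumes "strongly_measurable M f" and t: "simple_function M t"
  obtains h :: "'a \<Rightarrow> real"
    where "h \<in> borel_measurable M" "AE \<omega> in M. norm (f \<omega> - t \<omega>) = h \<omega>"
proof -
  from assms(1) obtain s f' where s: "\<And>n. simple_function M (s n)"
    and lim: "\<And>\<omega>. (\<lambda>n. s n \<omega>) \<longlonglongrightarrow> f' \<omega>" and ae: "AE \<omega> in M. f \<omega> = f' \<omega>"
    by (rule strongly_measurableE) blast
  have "(\<lambda>\<omega>. norm (f' \<omega> - t \<omega>)) \<in> borel_measurable M"
  proof (rule borel_measurable_LIMSEQ_metric)
    show "(\<lambda>\<omega>. norm (s n \<omega> - t \<omega>)) \<in> borel_measurable M" for n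
      using simple_function_compose2[OF s t, of "\<lambda>x y. norm (x - y)" n]
      by (rule borel_measurable_simple_function)
    show "(\<lambda>n. norm (s n \<omega> - t \<omega>)) \<longlonglongrightarrow> norm (f' \<omega> - t \<omega>)" for \<omega>
      by (intro tendsto_intros lim)
  qed
  moreover have "AE \<omega> in M. norm (f \<omega> - t \<omega>) = norm (f' \<omega> - t \<omega>)"
    using ae by eventually_elim simp
  ultimately show ?thesis
    by (rule that)
qed

section \<open>The strong integral\<close>

text \<open>This is the triangle inequality through \<open>f\<close> in the L1 distance, after
  bounding the norm of an integral by the integral of the norm. It makes integrals of
  L1-approximants a Cauchy sequence.\<close>

lemma norm_simple_bochner_integral_diff_le:
  fixes f :: "'a \<Rightarrow> 'b::real_normed_vector"
  assumes f: "strongly_measurable M f"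
    and s: "Bochner_Integration.simple_bochner_integrable M s"
    and t: "Bochner_Integration.simple_bochner_integrable M t"
  shows "ennreal (norm (Bochner_Integration.simple_bochner_integral M s -
      Bochner_Integration.simple_bochner_integral M t)) \<le>
    (\<integral>\<^sup>+\<omega>. norm (f \<omega> - s \<omega>) \<partial>M) + (\<integral>\<^sup>+\<omega>. norm (f \<omega> - t \<omega>) \<partial>M)"
    (is "ennreal (norm (?s - ?t)) \<le> _")
proof -
  have sf: "simple_function M s" "simple_function M t"
    using s t by (auto elim: simple_bochner_integrable.cases)
  \<comment> \<open>Additivity of \<open>nn_integral\<close> requires measurable integrands, so the
    two error terms are replaced by Borel representatives and restored at the end.\<close>
  obtain a where a[measurable]: "a \<in> borel_measurable M"
    and ae_a: "AE \<omega> in M. norm (f \<omega> - s \<omega>) = a \<omega>"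
    by (rule strongly_measurable_norm_diff[OF f sf(1)])
  obtain b where b[measurable]: "b \<in> borel_measurable M"
    and ae_b: "AE \<omega> in M. norm (f \<omega> - t \<omega>) = b \<omega>"
    by (rule strongly_measurable_norm_diff[OF f sf(2)])
  have diff: "Bochner_Integration.simple_bochner_integrable M (\<lambda>\<omega>. s \<omega> - t \<omega>)"
    by (intro simple_bochner_integrable_compose2[where p="(-)"] s t) simp
  have norm_diff: "Bochner_Integration.simple_bochner_integrable M (\<lambda>\<omega>. norm (s \<omega> - t \<omega>))"
    by (intro simple_bochner_integrable_compose2[where p="\<lambda>x y. norm (x - y)"] s t) simp
  have "ennreal (norm (?s - ?t)) =
      norm (Bochner_Integration.simple_bochner_integral M (\<lambda>\<omega>. s \<omega> - t \<omega>))"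
    using s t by (subst simple_bochner_integral_diff) auto
  also have "\<dots> \<le> Bochner_Integration.simple_bochner_integral M (\<lambda>\<omega>. norm (s \<omega> - t \<omega>))"
    by (intro ennreal_leI simple_bochner_integral_norm_bound diff)
  also have "\<dots> = (\<integral>\<^sup>+\<omega>. norm (s \<omega> - t \<omega>) \<partial>M)"
    using norm_diff by (rule simple_bochner_integral_eq_nn_integral) simp
  also have "\<dots> \<le> (\<integral>\<^sup>+\<omega>. ennreal (a \<omega>) + ennreal (b \<omega>) \<partial>M)"
  proof (rule nn_integral_mono_AE)
    show "AE \<omega> in M. ennreal (norm (s \<omega> - t \<omega>)) \<le> ennreal (a \<omega>) + ennreal (b \<omega>)"
      using ae_a ae_b
    proof eventually_elim
      case (elim \<omega>)
      have "norm (s \<omega> - t \<omega>) \<le> norm (f \<omega> - s \<omega>) + norm (f \<omega> - t \<omega>)"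
        \<comment> \<open>Here \<open>s - t\<close> is written as
          \<open>(f - t) - (f - s)\<close>.\<close>
        using norm_triangle_ineq4[of "f \<omega> - t \<omega>" "f \<omega> - s \<omega>"] by simp
      then show ?case
        by (simp flip: elim ennreal_plus add: ennreal_leI)
    qed
  qed
  also have "\<dots> = (\<integral>\<^sup>+\<omega>. ennreal (a \<omega>) \<partial>M) + (\<integral>\<^sup>+\<omega>. ennreal (b \<omega>) \<partial>M)"
    by (intro nn_integral_add) auto
  also have "(\<integral>\<^sup>+\<omega>. ennreal (a \<omega>) \<partial>M) = (\<integral>\<^sup>+\<omega>. norm (f \<omega> - s \<omega>) \<partial>M)"
    by (intro nn_integral_cong_AE, use ae_a in eventually_elim) simp
  also have "(\<integral>\<^sup>+\<omega>. ennreal (b \<omega>) \<partial>M) = (\<integral>\<^sup>+\<omega>. norm (f \<omega> - t \<omega>) \<partial>M)"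
    by (intro nn_integral_cong_AE, use ae_b in eventually_elim) simp
  finally show ?thesis .
qed

text \<open>Dominated convergence turns pointwise approximation into L1 approximation. The integrals
  of the approximants are then Cauchy, and completeness of the codomain supplies the value.\<close>

lemma has_strong_integral_exists:
  fixes f :: "'a \<Rightarrow> 'b::{real_normed_vector, complete_space}"
  assumes f: "strongly_measurable M f" and fin: "(\<integral>\<^sup>+\<omega>. ennreal (norm (f \<omega>)) \<partial>M) < \<infinity>"
  shows "\<exists>I. has_strong_integral M f I"
proof -
  from f obtain s f' where s: "\<And>n. simple_function M (s n)"
    and lim: "\<And>\<omega>. (\<lambda>n. s n \<omega>) \<longlonglongrightarrow> f' \<omega>" and f'[measurable]: "f' \<in> borel_measurable M"
    and ae: "AE \<omega> in M. f \<omega> = f' \<omega>"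
    by (rule strongly_measurableE) blast
  have s_borel[measurable]: "s n \<in> borel_measurable M" for n
    by (rule borel_measurable_simple_function[OF s])
  have fin': "(\<integral>\<^sup>+\<omega>. ennreal (norm (f' \<omega>)) \<partial>M) < \<infinity>"
  proof -
    have "(\<integral>\<^sup>+\<omega>. ennreal (norm (f' \<omega>)) \<partial>M) = (\<integral>\<^sup>+\<omega>. ennreal (norm (f \<omega>)) \<partial>M)"
      by (intro nn_integral_cong_AE, use ae in eventually_elim) simp
    with fin show ?thesis by simp
  qed
  \<comment> \<open>Truncation makes the approximating sequence dominated by an integrable function.\<close>
  define A where "A n = {\<omega> \<in> space M. norm (s n \<omega>) \<le> 2 * norm (f' \<omega>)}" for n
  define t where "t n \<omega> = (if \<omega> \<in> A n then s n \<omega> else 0)" for n \<omega>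
  have A: "A n \<in> sets M" for n
    unfolding A_def by measurable
  have t: "simple_function M (t n)" for n
    unfolding t_def using A s by (intro simple_function_If_set) auto
  have t_le: "norm (t n \<omega>) \<le> 2 * norm (f' \<omega>)" for n \<omega>
    by (simp add: t_def A_def)
  have t_lim: "(\<lambda>n. t n \<omega>) \<longlonglongrightarrow> f' \<omega>" if "\<omega> \<in> space M" for \<omega>
  proof (cases "f' \<omega> = 0")
    case True
    then have "t n \<omega> = 0" for n
      using t_le[of n \<omega>] by simp
    with True show ?thesis by simp
  next
    case False
    have "(\<lambda>n. norm (s n \<omega>)) \<longlonglongrightarrow> norm (f' \<omega>)"
      by (intro tendsto_norm lim)
    \<comment> \<open>Since \<open>f'\<close> is nonzero here, the factor 2 in \<open>A\<close>
      leaves room above the limit of the norms, so truncation eventually changes nothing.\<close>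
    then have "\<forall>\<^sub>F n in sequentially. norm (s n \<omega>) < 2 * norm (f' \<omega>)"
      by (rule order_tendstoD) (use False in simp)
    then have "\<forall>\<^sub>F n in sequentially. s n \<omega> = t n \<omega>"
      by eventually_elim (simp add: t_def A_def that)
    with lim show ?thesis
      by (rule Lim_transform_eventually)
  qed
  have t_int: "Bochner_Integration.simple_bochner_integrable M (t n)" for n
  proof (rule simple_bochner_integrableI_bounded[OF t])
    have "(\<integral>\<^sup>+\<omega>. ennreal (norm (t n \<omega>)) \<partial>M) \<le> (\<integral>\<^sup>+\<omega>. 2 * ennreal (norm (f' \<omega>)) \<partial>M)"
    proof (rule nn_integral_mono)
      show "ennreal (norm (t n \<omega>)) \<le> 2 * ennreal (norm (f' \<omega>))" for \<omega>
        using ennreal_leI[OF t_le[of n \<omega>]] by (simp add: ennreal_mult)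
    qed
    also have "\<dots> = 2 * (\<integral>\<^sup>+\<omega>. ennreal (norm (f' \<omega>)) \<partial>M)"
      by (intro nn_integral_cmult) measurable
    also have "\<dots> < \<infinity>"
      using fin' by (simp add: ennreal_mult_less_top)
    finally show "(\<integral>\<^sup>+\<omega>. ennreal (norm (t n \<omega>)) \<partial>M) < \<infinity>" .
  qed
  have conv: "(\<lambda>n. \<integral>\<^sup>+\<omega>. ennreal (norm (f \<omega> - t n \<omega>)) \<partial>M) \<longlonglongrightarrow> 0"
  proof -
    have "\<exists>h :: 'a \<Rightarrow> real. h \<in> borel_measurable M \<and> (AE \<omega> in M. norm (f \<omega> - t n \<omega>) = h \<omega>)" for n
      by (rule strongly_measurable_norm_diff[OF f t]) blast
    then obtain h :: "nat \<Rightarrow> 'a \<Rightarrow> real" where h[measurable]: "\<And>n. h n \<in> borel_measurable M"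
      and h_ae: "\<And>n. AE \<omega> in M. norm (f \<omega> - t n \<omega>) = h n \<omega>"
      by metis
    \<comment> \<open>There are only countably many \<open>n\<close>, so one null set serves for all
      representatives \<open>h n\<close>.\<close>
    have h_ae_all: "AE \<omega> in M. \<forall>n. norm (f' \<omega> - t n \<omega>) = h n \<omega>"
      unfolding AE_all_countable
    proof
      show "AE \<omega> in M. norm (f' \<omega> - t n \<omega>) = h n \<omega>" for n
        using h_ae[of n] ae by eventually_elim simp
    qed
    have "(\<lambda>n. \<integral>\<^sup>+\<omega>. ennreal (h n \<omega>) \<partial>M) \<longlonglongrightarrow> (\<integral>\<^sup>+\<omega>. 0 \<partial>M)"
    \<comment> \<open>The constant 3 is 1 for \<open>f'\<close> plus 2 for the truncation bound
      \<open>t_le\<close>.\<close>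
    proof (rule nn_integral_dominated_convergence[where w="\<lambda>\<omega>. 3 * ennreal (norm (f' \<omega>))"])
      show "AE \<omega> in M. ennreal (h n \<omega>) \<le> 3 * ennreal (norm (f' \<omega>))" for n
        using h_ae_all
      proof eventually_elim
        case (elim \<omega>)
        have "norm (f' \<omega> - t n \<omega>) \<le> 3 * norm (f' \<omega>)"
          using norm_triangle_ineq4[of "f' \<omega>" "t n \<omega>"] t_le[of n \<omega>] by linarith
        then have "ennreal (h n \<omega>) \<le> ennreal (3 * norm (f' \<omega>))"
          using elim by (auto intro: ennreal_leI)
        then show ?case by (simp add: ennreal_mult)
      qed
      have "(\<integral>\<^sup>+\<omega>. 3 * ennreal (norm (f' \<omega>)) \<partial>M) = 3 * (\<integral>\<^sup>+\<omega>. ennreal (norm (f' \<omega>)) \<partial>M)"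
        by (intro nn_integral_cmult) measurable
      then show "(\<integral>\<^sup>+\<omega>. 3 * ennreal (norm (f' \<omega>)) \<partial>M) < \<infinity>"
        using fin' by (simp add: ennreal_mult_less_top)
      show "AE \<omega> in M. (\<lambda>n. ennreal (h n \<omega>)) \<longlonglongrightarrow> 0"
        using h_ae_all AE_space
      proof eventually_elim
        case (elim \<omega>)
        have "(\<lambda>n. norm (f' \<omega> - t n \<omega>)) \<longlonglongrightarrow> norm (f' \<omega> - f' \<omega>)"
          by (intro tendsto_intros t_lim elim)
        then have "(\<lambda>n. h n \<omega>) \<longlonglongrightarrow> 0"
          using elim by simp
        then show ?case
          using tendsto_ennrealI by fastforce
      qed
    qed measurable
    moreover have "(\<integral>\<^sup>+\<omega>. ennreal (norm (f \<omega> - t n \<omega>)) \<partial>M) = (\<integral>\<^sup>+\<omega>. ennreal (h n \<omega>) \<partial>M)" for n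
      by (intro nn_integral_cong_AE, use h_ae[of n] in eventually_elim) simp
    ultimately show ?thesis by simp
  qed
  have "Cauchy (\<lambda>n. Bochner_Integration.simple_bochner_integral M (t n))"
  proof (rule metric_CauchyI)
    fix e :: real assume "e > 0"
    then have "\<forall>\<^sub>F n in sequentially. (\<integral>\<^sup>+\<omega>. ennreal (norm (f \<omega> - t n \<omega>)) \<partial>M) < ennreal (e / 2)"
      by (intro order_tendstoD(2)[OF conv]) simp
    then obtain N where N: "(\<integral>\<^sup>+\<omega>. ennreal (norm (f \<omega> - t n \<omega>)) \<partial>M) < ennreal (e / 2)"
      if "n \<ge> N" for n
      by (auto simp: eventually_sequentially)
    show "\<exists>N. \<forall>m\<ge>N. \<forall>n\<ge>N. dist (Bochner_Integration.simple_bochner_integral M (t m))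
        (Bochner_Integration.simple_bochner_integral M (t n)) < e"
    proof (intro exI allI impI)
      fix m n assume mn: "m \<ge> N" "n \<ge> N"
      let ?d = "dist (Bochner_Integration.simple_bochner_integral M (t m))
        (Bochner_Integration.simple_bochner_integral M (t n))"
      have "ennreal ?d \<le> (\<integral>\<^sup>+\<omega>. ennreal (norm (f \<omega> - t m \<omega>)) \<partial>M) +
          (\<integral>\<^sup>+\<omega>. ennreal (norm (f \<omega> - t n \<omega>)) \<partial>M)"
        unfolding dist_norm by (rule norm_simple_bochner_integral_diff_le[OF f t_int t_int])
      also have "\<dots> < ennreal (e / 2) + ennreal (e / 2)"
        by (intro add_strict_mono N mn)
      also have "\<dots> = ennreal e"
        using \<open>e > 0\<close> by (simp flip: ennreal_plus)
      finally show "?d < e"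
        using \<open>e > 0\<close> by (simp add: ennreal_less_iff)
    qed
  qed
  then obtain I where "(\<lambda>n. Bochner_Integration.simple_bochner_integral M (t n)) \<longlonglongrightarrow> I"
    using Cauchy_convergent convergent_def by blast
  with f t_int conv show ?thesis
    unfolding has_strong_integral_def by blast
qed

text \<open>Applying \<open>T\<close> to the simple approximants of \<open>f\<close> gives simple
  approximants of \<open>h\<close>, whose L1 error grows by at most a bound \<open>K\<close> for
  \<open>T\<close>. On simple functions \<open>T\<close> commutes with the integral. The Borel
  representative \<open>h\<close> is there because the composition of \<open>T\<close> with
  \<open>f\<close> is Borel only up to a null set.\<close>

lemma has_strong_integral_bounded_linear:
  fixes f :: "'a \<Rightarrow> 'b::real_normed_vector" and T :: "'b \<Rightarrow> real"
  assumes I: "has_strong_integral M f I" and T: "bounded_linear T"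
    and h: "h \<in> borel_measurable M" and h_ae: "AE \<omega> in M. T (f \<omega>) = h \<omega>"
  shows "has_bochner_integral M h (T I)"
proof -
  interpret T: bounded_linear T by (rule T)
  from I obtain s where f: "strongly_measurable M f"
    and s: "\<And>n. Bochner_Integration.simple_bochner_integrable M (s n)"
    and conv: "(\<lambda>n. \<integral>\<^sup>+\<omega>. ennreal (norm (f \<omega> - s n \<omega>)) \<partial>M) \<longlonglongrightarrow> 0"
    and lim: "(\<lambda>n. Bochner_Integration.simple_bochner_integral M (s n)) \<longlonglongrightarrow> I"
    by (auto simp: has_strong_integral_def)
  obtain K where K: "K > 0" "\<And>v. norm (T v) \<le> norm v * K"
    using T.pos_bounded by blast
  have bound: "(\<integral>\<^sup>+\<omega>. ennreal (norm (h \<omega> - T (s n \<omega>))) \<partial>M) \<le>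
      ennreal K * (\<integral>\<^sup>+\<omega>. ennreal (norm (f \<omega> - s n \<omega>)) \<partial>M)" for n
  proof -
    have "simple_function M (s n)"
      using s by (auto elim: simple_bochner_integrable.cases)
    then obtain a :: "'a \<Rightarrow> real"
      where a[measurable]: "a \<in> borel_measurable M"
        and ae_a: "AE \<omega> in M. norm (f \<omega> - s n \<omega>) = a \<omega>"
      by (rule strongly_measurable_norm_diff[OF f])
    have "(\<integral>\<^sup>+\<omega>. ennreal (norm (h \<omega> - T (s n \<omega>))) \<partial>M) \<le> (\<integral>\<^sup>+\<omega>. ennreal K * ennreal (a \<omega>) \<partial>M)"
    proof (rule nn_integral_mono_AE)
      show "AE \<omega> in M. ennreal (norm (h \<omega> - T (s n \<omega>))) \<le> ennreal K * ennreal (a \<omega>)"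
        using h_ae ae_a
      proof eventually_elim
        case (elim \<omega>)
        have "norm (h \<omega> - T (s n \<omega>)) \<le> K * a \<omega>"
          using K(2)[of "f \<omega> - s n \<omega>"] elim by (simp add: T.diff mult.commute)
        moreover have "0 \<le> a \<omega>"
          using elim(2) norm_ge_zero by metis
        ultimately show ?case
          using K(1) by (metis ennreal_leI ennreal_mult less_imp_le)
      qed
    qed
    also have "\<dots> = ennreal K * (\<integral>\<^sup>+\<omega>. ennreal (a \<omega>) \<partial>M)"
      by (intro nn_integral_cmult) measurable
    also have "(\<integral>\<^sup>+\<omega>. ennreal (a \<omega>) \<partial>M) = (\<integral>\<^sup>+\<omega>. ennreal (norm (f \<omega> - s n \<omega>)) \<partial>M)"
      by (intro nn_integral_cong_AE, use ae_a in eventually_elim) simp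
    finally show ?thesis .
  qed
  have "(\<lambda>n. ennreal K * (\<integral>\<^sup>+\<omega>. ennreal (norm (f \<omega> - s n \<omega>)) \<partial>M)) \<longlonglongrightarrow> ennreal K * 0"
    by (intro ennreal_tendsto_cmult conv) simp
  then have upper: "(\<lambda>n. ennreal K * (\<integral>\<^sup>+\<omega>. ennreal (norm (f \<omega> - s n \<omega>)) \<partial>M)) \<longlonglongrightarrow> 0"
    by simp
  have conv': "(\<lambda>n. \<integral>\<^sup>+\<omega>. ennreal (norm (h \<omega> - T (s n \<omega>))) \<partial>M) \<longlonglongrightarrow> 0"
    by (rule tendsto_sandwich[OF always_eventually always_eventually tendsto_const upper])
      (use bound in \<open>simp_all only: zero_le simp_thms\<close>)
  have "(\<lambda>n. T (Bochner_Integration.simple_bochner_integral M (s n))) \<longlonglongrightarrow> T I"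
    by (rule T.tendsto[OF lim])
  then have lim': "(\<lambda>n. Bochner_Integration.simple_bochner_integral M (\<lambda>\<omega>. T (s n \<omega>))) \<longlonglongrightarrow> T I"
    by (simp add: simple_bochner_integral_linear[OF T.linear_axioms s])
  have "Bochner_Integration.simple_bochner_integrable M (\<lambda>\<omega>. T (s n \<omega>))" for n
    \<comment> \<open>The binary composition rule is used with a function that ignores its second
      argument.\<close>
    by (rule simple_bochner_integrable_compose2[where p="\<lambda>x _. T x", OF _ s s]) (simp add: T.zero)
  with h conv' lim' show ?thesis
    by (intro has_bochner_integral.intros)
qed

lemma strongly_measurable_bounded_linear:
  fixes T :: "'b::real_normed_vector \<Rightarrow> real"
  assumes "strongly_measurable M f" and "bounded_linear T"
  obtains h where "h \<in> borel_measurable M" "AE \<omega> in M. T (f \<omega>) = h \<omega>"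
  using strongly_measurable_continuous_compose[OF assms(1) linear_continuous_on[OF assms(2)]]
  by (rule strongly_measurableE) blast

lemma has_strong_integral_unique:
  fixes f :: "'a \<Rightarrow> 'b::complex_inner"
  assumes I: "has_strong_integral M f I" and J: "has_strong_integral M f J"
  shows "I = J"
proof -
  \<comment> \<open>A single functional separates the two candidates: its value at
    \<open>I - J\<close> is the squared norm of \<open>I - J\<close>.\<close>
  define T where "T v = Re (cinner v (I - J))" for v
  have T: "bounded_linear T"
    unfolding T_def by (rule bounded_linear_Re_cinner_left)
  obtain h where h: "h \<in> borel_measurable M" "AE \<omega> in M. T (f \<omega>) = h \<omega>"
    using I T by (auto simp: has_strong_integral_def elim: strongly_measurable_bounded_linear)
  have "T I = T J"
    by (rule has_bochner_integral_eq[OF has_strong_integral_bounded_linear[OF I T h]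
          has_strong_integral_bounded_linear[OF J T h]])
  then have "T (I - J) = 0"
    by (simp add: linear_diff[OF bounded_linear.linear[OF T]])
  then show ?thesis
    by (simp add: T_def cinner_self)
qed

lemma strong_integral_eq:
  fixes f :: "'a \<Rightarrow> 'b::complex_inner"
  assumes "has_strong_integral M f I"
  shows "strong_integral M f = I"
proof -
  have "(THE J. has_strong_integral M f J) = I"
    using assms by (rule the_equality) (rule has_strong_integral_unique[OF _ assms])
  with assms show ?thesis
    unfolding strong_integral_def by (metis (full_types))
qed

text \<open>The constant zero sequence witnesses both strong measurability and the integral, so the
  value 0 is a genuine integral and not the default.\<close>

lemma strong_integral_AE_zero:
  fixes f :: "'a \<Rightarrow> 'b::complex_inner"
  assumes ae: "AE \<omega> in M. f \<omega> = 0"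
  shows "strong_integral M f = 0"
proof (rule strong_integral_eq)
  have "strongly_measurable M f"
    unfolding strongly_measurable_def
    using ae by (intro exI[of _ "\<lambda>_ _. 0"]) (auto elim: eventually_mono)
  moreover have "(\<integral>\<^sup>+\<omega>. ennreal (norm (f \<omega> - 0)) \<partial>M) = 0"
  proof -
    have "(\<integral>\<^sup>+\<omega>. ennreal (norm (f \<omega> - 0)) \<partial>M) = (\<integral>\<^sup>+\<omega>. 0 \<partial>M)"
      by (intro nn_integral_cong_AE, use ae in eventually_elim) simp
    then show ?thesis by simp
  qed
  moreover have "Bochner_Integration.simple_bochner_integrable M (\<lambda>_. 0 :: 'b)"
    by (rule simple_bochner_integrable.intros) simp_all
  moreover have "Bochner_Integration.simple_bochner_integral M (\<lambda>_. 0 :: 'b) = 0"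
    unfolding simple_bochner_integral_def by (rule sum.neutral) auto
  ultimately show "has_strong_integral M f 0"
    unfolding has_strong_integral_def by (intro conjI exI[of _ "\<lambda>_ _. 0"]) simp_all
qed

section \<open>Null spaces of covariance operators\<close>

text \<open>By Cauchy-Schwarz the integrand has norm at most \<open>norm x\<close> times the squared
  norm of \<open>f\<close>, which has finite integral because \<open>f\<close> is in
  \<open>L2 M\<close>.\<close>

lemma covariance_self_integrable:
  fixes f :: "'a \<Rightarrow> 'h::complex_hilbert_space"
  assumes "f \<in> L2 M"
  shows "has_strong_integral M (\<lambda>\<omega>. cinner x (f \<omega>) *\<^sub>C f \<omega>) (covariance M f f x)"
proof -
  have f: "strongly_measurable M f" and fin: "(\<integral>\<^sup>+\<omega>. ennreal ((norm (f \<omega>))\<^sup>2) \<partial>M) < \<infinity>"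
    using assms by (auto simp: L2_def)
  have "continuous_on UNIV (\<lambda>v. cinner x v *\<^sub>C v)"
    by (intro bounded_bilinear.continuous_on[OF bounded_bilinear_scaleC]
        bounded_bilinear.continuous_on[OF bounded_bilinear_cinner] continuous_intros)
  from strongly_measurable_continuous_compose[OF f this]
  have meas: "strongly_measurable M (\<lambda>\<omega>. cinner x (f \<omega>) *\<^sub>C f \<omega>)" .
  from f obtain f' where f'[measurable]: "f' \<in> borel_measurable M"
    and ae: "AE \<omega> in M. f \<omega> = f' \<omega>"
    by (rule strongly_measurableE) blast
  have "(\<integral>\<^sup>+\<omega>. ennreal (norm (cinner x (f \<omega>) *\<^sub>C f \<omega>)) \<partial>M) \<le>
      (\<integral>\<^sup>+\<omega>. ennreal (norm x) * ennreal ((norm (f' \<omega>))\<^sup>2) \<partial>M)"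
  proof (rule nn_integral_mono_AE)
    show "AE \<omega> in M. ennreal (norm (cinner x (f \<omega>) *\<^sub>C f \<omega>)) \<le>
        ennreal (norm x) * ennreal ((norm (f' \<omega>))\<^sup>2)"
      using ae
    proof eventually_elim
      case (elim \<omega>)
      have "norm (cinner x (f \<omega>) *\<^sub>C f \<omega>) \<le> norm x * norm (f \<omega>) * norm (f \<omega>)"
        unfolding norm_scaleC by (intro mult_right_mono Cauchy_Schwarz_cinner) simp
      then show ?case
        using elim by (simp flip: ennreal_mult add: ennreal_leI power2_eq_square mult.assoc)
    qed
  qed
  also have "\<dots> = ennreal (norm x) * (\<integral>\<^sup>+\<omega>. ennreal ((norm (f' \<omega>))\<^sup>2) \<partial>M)"
    by (intro nn_integral_cmult) measurable
  also have "(\<integral>\<^sup>+\<omega>. ennreal ((norm (f' \<omega>))\<^sup>2) \<partial>M) = (\<integral>\<^sup>+\<omega>. ennreal ((norm (f \<omega>))\<^sup>2) \<partial>M)"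
    by (intro nn_integral_cong_AE, use ae in eventually_elim) simp
  also have "ennreal (norm x) * \<dots> < \<infinity>"
    using fin by (simp add: ennreal_mult_less_top)
  finally obtain I where "has_strong_integral M (\<lambda>\<omega>. cinner x (f \<omega>) *\<^sub>C f \<omega>) I"
    using has_strong_integral_exists[OF meas] by blast
  then show ?thesis
    by (simp add: covariance_def strong_integral_eq)
qed

lemma covariance_self_eq_zero_imp_AE:
  fixes f :: "'a \<Rightarrow> 'h::complex_hilbert_space"
  assumes f: "f \<in> L2 M" and zero: "covariance M f f x = 0"
  shows "AE \<omega> in M. cinner x (f \<omega>) = 0"
proof -
  let ?T = "\<lambda>v. Re (cinner v x)"
  from f have "strongly_measurable M f" by (simp add: L2_def)
  moreover have "continuous_on UNIV (\<lambda>v. (cmod (cinner x v))\<^sup>2)"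
    by (intro continuous_intros bounded_bilinear.continuous_on[OF bounded_bilinear_cinner])
  ultimately have "strongly_measurable M (\<lambda>\<omega>. (cmod (cinner x (f \<omega>)))\<^sup>2)"
    by (rule strongly_measurable_continuous_compose)
  then obtain h where h[measurable]: "h \<in> borel_measurable M"
    and h_ae: "AE \<omega> in M. (cmod (cinner x (f \<omega>)))\<^sup>2 = h \<omega>"
    by (rule strongly_measurableE) blast
  \<comment> \<open>Pairing the covariance integrand with \<open>x\<close> multiplies
    \<open>cinner x v\<close> by its conjugate \<open>cinner v x\<close>, which makes it a
    nonnegative real.\<close>
  have T_eq: "?T (cinner x v *\<^sub>C v) = (cmod (cinner x v))\<^sup>2" for v
  proof -
    have "cinner (cinner x v *\<^sub>C v) x = cinner x v * cnj (cinner x v)"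
      unfolding cinner_scaleC_left by (subst cinner_commute[of v x]) simp
    also have "\<dots> = complex_of_real ((cmod (cinner x v))\<^sup>2)"
      by (simp only: complex_norm_square)
    finally show ?thesis by simp
  qed
  \<comment> \<open>The strong integral of the integrand is \<open>covariance M f f x\<close>, which
    is 0 by assumption, so \<open>h\<close> integrates to the functional's value at 0.\<close>
  have "has_bochner_integral M h (?T 0)"
    using has_strong_integral_bounded_linear[OF covariance_self_integrable[OF f, of x]
        bounded_linear_Re_cinner_left[of x] h] h_ae zero
    by (simp add: T_eq)
  then have "has_bochner_integral M h 0"
    by (simp add: linear_0[OF bounded_linear.linear[OF bounded_linear_Re_cinner_left]])
  then have "integrable M h" "integral\<^sup>L M h = 0"
    by (auto simp: has_bochner_integral_iff)
  moreover have "AE \<omega> in M. 0 \<le> h \<omega>"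
    using h_ae by eventually_elim (metis zero_le_power2)
  ultimately have "AE \<omega> in M. h \<omega> = 0"
    using integral_nonneg_eq_0_iff_AE by blast
  with h_ae show ?thesis
    by eventually_elim simp
qed

theorem lemma8p1:
  fixes M :: "'a measure"
    and f :: "'a \<Rightarrow> 'h::complex_hilbert_space"
    and g :: "'a \<Rightarrow> 'k::complex_hilbert_space"
    and P Q :: "'h set"
  assumes "prob_space M"
    and "f \<in> L2 M" and "g \<in> L2 M"
    and "strong_integral M f = 0" and "strong_integral M g = 0"
    and "P = covariance M f f -` {0}"
    and "Q = covariance M g f -` {0}"
  shows "P \<subseteq> Q \<and> Q \<subseteq> (UNIV :: 'h set)"
proof -
  have "covariance M g f x = 0" if "covariance M f f x = 0" for x
    unfolding covariance_def
  proof (rule strong_integral_AE_zero)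
    \<comment> \<open>The scalar factor is the same for both operators, so the null set found for
      the auto-covariance also serves for the cross-covariance.\<close>
    show "AE \<omega> in M. cinner x (f \<omega>) *\<^sub>C g \<omega> = 0"
      using covariance_self_eq_zero_imp_AE[OF \<open>f \<in> L2 M\<close> that]
      by eventually_elim (simp add: scaleC_zero_left)
  qed
  then show ?thesis
    unfolding \<open>P = _\<close> \<open>Q = _\<close> by auto
qed

end
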